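(* Let $T>0$, $\underline v>0$, $v\in L^\infty(\mathbb R;\mathbb R_{\ge \underline v})$, $\lambda\in L^\infty((0,T);W^{1,\infty}(\mathbb R))$ and $x_0\in\mathbb R$. There exists a unique Carathéodory solution of the initial value problem $x'(t)=v(x(t))\lambda(t,x(t))$, $x(0)=x_0$, on $[0,T]$ if and only if there exists a unique solution of this problem in the integral sense.
   Context: $L^\infty(\mathbb R;\mathbb R_{\ge\underline v})$ is the set of essentially bounded measurable functions on $\mathbb R$ with values in $[\underline v,\infty)$. Solution in the integral sense: a function $x\in C([0,T])$ with $$\int_{x_0}^{x(t)}\frac{1}{v(y)}\,dy=\int_0^t\lambda(s,x(s))\,ds\qquad\forall t\in[0,T].$$ Carathéodory solution: a function $x\in C([0,T])$ such that $t\mapsto v(x(t))\lambda(t,x(t))$ is Lebesgue measurable and $$x(t)=x_0+\int_0^t v(x(s))\lambda(s,x(s))\,ds\qquad\forall t\in[0,T].$$ *)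

theory Defs
  imports "HOL-Probability.Essential_Supremum"
begin

section \<open>Function spaces\<close>

definition Linf :: "(real \<Rightarrow> real) set" where
  "Linf = {f \<in> borel_measurable lebesgue. \<exists>C. AE y in lebesgue. \<bar>f y\<bar> \<le> C}"

text \<open>The lower bound holds everywhere, not just almost everywhere: elements are functions with
  values in \<open>[m, \<infinity>)\<close>, so that \<open>v (x t)\<close> is meaningful even when \<open>x\<close> spends
  positive time in a null set.\<close>

definition Linf_ge :: "real \<Rightarrow> (real \<Rightarrow> real) set" where
  "Linf_ge m = {f \<in> Linf. \<forall>y. m \<le> f y}"

definition Linf_norm :: "(real \<Rightarrow> real) \<Rightarrow> ennreal" where
  "Linf_norm f = esssup lebesgue (\<lambda>y. ennreal \<bar>f y\<bar>)"

definition test_functions :: "(real \<Rightarrow> real) set" where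
  "test_functions =
     {\<phi>. (\<forall>n y. (deriv ^^ n) \<phi> field_differentiable (at y)) \<and> compact (closure {y. \<phi> y \<noteq> 0})}"

definition locally_integrable :: "(real \<Rightarrow> real) \<Rightarrow> bool" where
  "locally_integrable f \<longleftrightarrow> (\<forall>K. compact K \<longrightarrow> set_integrable lebesgue K f)"

definition has_weak_derivative :: "(real \<Rightarrow> real) \<Rightarrow> (real \<Rightarrow> real) \<Rightarrow> bool" where
  "has_weak_derivative f g \<longleftrightarrow>
     locally_integrable f \<and> locally_integrable g \<and>
     (\<forall>\<phi>\<in>test_functions. (LINT y|lebesgue. f y * deriv \<phi> y) = - (LINT y|lebesgue. g y * \<phi> y))"

text \<open>The weak derivative is unique only almost everywhere; the choice is immaterial below.\<close>

definition weak_deriv :: "(real \<Rightarrow> real) \<Rightarrow> real \<Rightarrow> real" where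
  "weak_deriv f = (SOME g. has_weak_derivative f g)"

text \<open>Each class in \<open>W\<^sup>1\<^sup>,\<^sup>\<infinity>(\<real>)\<close> contains exactly one continuous function, by which it is
  represented here. This gives meaning to the point values of its elements.\<close>

definition W1inf :: "(real \<Rightarrow> real) set" where
  "W1inf = {f \<in> Linf. continuous_on UNIV f \<and> (\<exists>g\<in>Linf. has_weak_derivative f g)}"

definition W1inf_norm :: "(real \<Rightarrow> real) \<Rightarrow> ennreal" where
  "W1inf_norm f = Linf_norm f + Linf_norm (weak_deriv f)"

text \<open>\<open>L\<^sup>\<infinity>((0,T); W\<^sup>1\<^sup>,\<^sup>\<infinity>(\<real>))\<close> in the sense of Bochner. The library's
  \<open>borel_measurable\<close> is not the right notion of measurability for values in this
  non-separable space, so strong measurability (almost everywhere approximability in norm by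
  simple functions) is spelled out.\<close>

definition Linf_W1inf :: "real \<Rightarrow> (real \<Rightarrow> real \<Rightarrow> real) set" where
  "Linf_W1inf T = {l.
     (\<forall>t\<in>{0<..<T}. l t \<in> W1inf) \<and>
     (\<exists>s. (\<forall>n. simple_function (lebesgue_on {0<..<T}) (s n) \<and> (\<forall>t\<in>{0<..<T}. s n t \<in> W1inf)) \<and>
          (AE t in lebesgue_on {0<..<T}.
             (\<lambda>n. W1inf_norm (\<lambda>y. s n t y - l t y)) \<longlonglongrightarrow> 0)) \<and>
     (\<exists>C::real. AE t in lebesgue_on {0<..<T}. W1inf_norm (l t) \<le> ennreal C)}"

text \<open>Extensionality makes equality of elements coincide with equality on \<open>[0,T]\<close>.\<close>

definition C_interval :: "real \<Rightarrow> (real \<Rightarrow> real) set" where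
  "C_interval T = {x \<in> extensional {0..T}. continuous_on {0..T} x}"

section \<open>Solution concepts for \<open>x'(t) = v(x(t)) \<lambda>(t,x(t))\<close>, \<open>x(0) = x0\<close>\<close>

definition integral_sense_solution ::
  "real \<Rightarrow> (real \<Rightarrow> real) \<Rightarrow> (real \<Rightarrow> real \<Rightarrow> real) \<Rightarrow> real \<Rightarrow> (real \<Rightarrow> real) \<Rightarrow> bool" where
  "integral_sense_solution T v l x0 x \<longleftrightarrow>
     x \<in> C_interval T \<and>
     (\<forall>t\<in>{0..T}. (LINT y=x0..x t|lebesgue. (1 / v y)) = (LINT s=0..t|lebesgue. (l s (x s))))"

text \<open>Existence of the integral is implicit in the integral equation; it is required explicitly
  because the library's integral is \<open>0\<close> for a non-integrable function.\<close>

definition caratheodory_solution ::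
  "real \<Rightarrow> (real \<Rightarrow> real) \<Rightarrow> (real \<Rightarrow> real \<Rightarrow> real) \<Rightarrow> real \<Rightarrow> (real \<Rightarrow> real) \<Rightarrow> bool" where
  "caratheodory_solution T v l x0 x \<longleftrightarrow>
     x \<in> C_interval T \<and>
     (\<lambda>t. v (x t) * l t (x t)) \<in> borel_measurable (lebesgue_on {0<..<T}) \<and>
     set_integrable lebesgue {0<..<T} (\<lambda>t. v (x t) * l t (x t)) \<and>
     (\<forall>t\<in>{0..T}. x t = x0 + (LINT s=0..t|lebesgue. (v (x s) * l s (x s))))"

end

theory Submission
  imports Defs
begin

text \<open>The two notions of solution coincide function by function. The main tool is the substitution rule
  \<open>\<integral> h(y) dy = \<integral> h(X(s)) g(s) ds\<close>, the left integral running from \<open>X(a)\<close> to \<open>X(b)\<close>, for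
  \<open>X\<close> an indefinite integral of \<open>g\<close> and \<open>h\<close> bounded Borel: it holds for continuous \<open>h\<close> by the mean
  value theorem and passes to Borel \<open>h\<close> by a monotone class argument, so no almost everywhere
  differentiation is needed. For \<open>h\<close> the indicator of a null set \<open>B\<close> it shows that \<open>g = 0\<close> almost
  everywhere on \<open>{s. X s \<in> B}\<close>; hence \<open>v\<close> may be replaced by a Borel representative \<open>v'\<close>, although a
  solution may spend positive time where \<open>v\<close> and \<open>v'\<close> differ. One direction is then substitution with
  \<open>X = x\<close>, \<open>h = 1 / v'\<close>. For the other, let \<open>F\<close> be the antiderivative of \<open>1 / v'\<close> and \<open>G\<close> its
  inverse; substitution with \<open>X = F\<close> shows that \<open>G\<close> is an antiderivative of \<open>v' \<circ> G\<close>, and then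
  substitution with \<open>X = F \<circ> x\<close>, \<open>h = v' \<circ> G\<close> recovers the Caratheodory equation.\<close>

section \<open>Substitution for absolutely continuous functions\<close>

lemma integrable_bounded_mult:
  fixes f g :: "'a \<Rightarrow> real"
  assumes "integrable M g" "f \<in> borel_measurable M" "\<And>s. s \<in> space M \<Longrightarrow> \<bar>f s\<bar> \<le> C"
  shows "integrable M (\<lambda>s. f s * g s)"
proof (rule Bochner_Integration.integrable_bound)
  show "integrable M (\<lambda>s. C * g s)" using assms by simp
  show "AE s in M. norm (f s * g s) \<le> norm (C * g s)"
    using assms(3) by (intro AE_I2) (fastforce simp: abs_mult intro: mult_right_mono)
qed (use assms in measurable)

text \<open>The functions \<open>g\<close> and \<open>k\<close> are densities of signed measures,
  pushed to the real line by \<open>X\<close> and \<open>Y\<close>. Equality on the half-lines, an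
  intersection-stable generator, extends to all Borel sets by Dynkin's induction, where
  \<open>total\<close> handles complements, and from there to simple and then to bounded Borel
  functions.\<close>

lemma integral_transport_eq:
  fixes X :: "'a \<Rightarrow> real" and Y :: "'b \<Rightarrow> real" and g :: "'a \<Rightarrow> real" and k :: "'b \<Rightarrow> real"
  assumes X [measurable]: "X \<in> borel_measurable M" and Y [measurable]: "Y \<in> borel_measurable N"
    and g: "integrable M g" and k: "integrable N k"
    and total: "(\<integral>s. g s \<partial>M) = (\<integral>s. k s \<partial>N)"
    and atMost: "\<And>c. (\<integral>s. indicator {..c} (X s) * g s \<partial>M) = (\<integral>s. indicator {..c} (Y s) * k s \<partial>N)"
    and h: "h \<in> borel_measurable borel" and bound: "\<And>y. \<bar>h y\<bar> \<le> C"
  shows "(\<integral>s. h (X s) * g s \<partial>M) = (\<integral>s. h (Y s) * k s \<partial>N)"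
proof -
  note [measurable] = borel_measurable_integrable[OF g] borel_measurable_integrable[OF k]
  define P where "P u \<longleftrightarrow> (\<integral>s. u (X s) * g s \<partial>M) = (\<integral>s. u (Y s) * k s \<partial>N)" for u :: "real \<Rightarrow> real"
  have int: "integrable M (\<lambda>s. u (X s) * g s)" "integrable N (\<lambda>s. u (Y s) * k s)"
    if [measurable]: "u \<in> borel_measurable borel" and "\<And>y. \<bar>u y\<bar> \<le> K" for u K
    using that(2) by (auto intro!: integrable_bounded_mult[of _ _ _ K] g k)
  \<comment> \<open>\<open>P\<close> is closed under uniformly bounded pointwise limits;
    \<open>K\<close> times the modulus of the density dominates.\<close>
  have lim: "P u"
    if [measurable]: "\<And>n. U n \<in> borel_measurable borel"
      and [measurable]: "u \<in> borel_measurable borel"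
      and bd: "\<And>n y. \<bar>U n y\<bar> \<le> K" and cv: "\<And>y. (\<lambda>n. U n y) \<longlonglongrightarrow> u y"
      and PU: "\<And>n. P (U n)" for U :: "nat \<Rightarrow> real \<Rightarrow> real" and u K
  proof -
    have "(\<lambda>n. \<integral>s. U n (X s) * g s \<partial>M) \<longlonglongrightarrow> (\<integral>s. u (X s) * g s \<partial>M)"
      by (rule integral_dominated_convergence[where w = "\<lambda>s. K * \<bar>g s\<bar>"])
         (auto intro!: tendsto_intros cv AE_I2 mult_right_mono bd integrable_mult_right integrable_abs g
               simp: abs_mult)
    moreover have "(\<lambda>n. \<integral>s. U n (Y s) * k s \<partial>N) \<longlonglongrightarrow> (\<integral>s. u (Y s) * k s \<partial>N)"
      by (rule integral_dominated_convergence[where w = "\<lambda>s. K * \<bar>k s\<bar>"])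
         (auto intro!: tendsto_intros cv AE_I2 mult_right_mono bd integrable_mult_right integrable_abs k
               simp: abs_mult)
    ultimately show "P u"
      using PU unfolding P_def by (simp add: LIMSEQ_unique)
  qed
  have sums: "P (\<lambda>y. \<Sum>i\<in>I. c i * indicator (A i) y)"
    if "finite I" and A: "\<And>i. i \<in> I \<Longrightarrow> A i \<in> sets borel" and PA: "\<And>i. i \<in> I \<Longrightarrow> P (indicator (A i))"
    for I :: "'i set" and c :: "'i \<Rightarrow> real" and A
  proof -
    have M: "integrable M (\<lambda>s. c i * (indicator (A i) (X s) * g s))"
      and N: "integrable N (\<lambda>s. c i * (indicator (A i) (Y s) * k s))" if "i \<in> I" for i
      using A[OF that] by (auto intro!: integrable_mult_right int[of _ 1] simp: indicator_def)
    show ?thesis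
      unfolding P_def using M N PA
      by (simp add: sum_distrib_right mult.assoc Bochner_Integration.integral_sum P_def)
  qed
  have sets: "P (indicator A)" if "A \<in> sets borel" for A
  proof -
    have gen: "A \<in> sigma_sets UNIV (range (\<lambda>a::real. {..a}))"
      using that by (simp add: borel_eq_atMost)
    have "Int_stable (range (\<lambda>a::real. {..a}))"
      by (auto simp: Int_stable_def)
    moreover have "range (\<lambda>a::real. {..a}) \<subseteq> Pow UNIV"
      by simp
    ultimately show ?thesis
      using gen
    proof (induction rule: sigma_sets_induct_disjoint)
      case (compl A)
      have [measurable]: "A \<in> sets borel"
        using compl by (simp add: borel_eq_atMost)
      have "indicator (UNIV - A) y = 1 - (indicator A y :: real)" for y
        by (auto simp: indicator_def)
      moreover have "integrable M (\<lambda>s. indicator A (X s) * g s)" "integrable N (\<lambda>s. indicator A (Y s) * k s)"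
        by (auto intro!: int[of _ 1] simp: indicator_def)
      ultimately show ?case
        using compl.IH g k total by (simp add: P_def left_diff_distrib)
    next
      case (union A)
      have A: "A i \<in> sets borel" for i
        using union by (auto simp: borel_eq_atMost)
      show ?case
      proof (rule lim[where U = "\<lambda>n y. \<Sum>i<n. 1 * indicator (A i) y" and K = 1])
        \<comment> \<open>Disjointness makes the partial sums indicators, which supplies the bound 1
          for all \<open>n\<close>.\<close>
        have eq: "(\<Sum>i<n. 1 * indicator (A i) y) = (indicator (\<Union>i<n. A i) y :: real)" for n y
          using union by (subst indicator_UN_disjoint) (auto simp: disjoint_family_on_def)
        show "\<bar>\<Sum>i<n. 1 * indicator (A i) y\<bar> \<le> (1::real)" for n y
          unfolding eq by (simp add: indicator_def)
        show "(\<lambda>n. \<Sum>i<n. 1 * indicator (A i) y) \<longlonglongrightarrow> (indicator (\<Union> (range A)) y :: real)" for y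
          unfolding eq by (rule LIMSEQ_indicator_UN)
        show "P (\<lambda>y. \<Sum>i<n. 1 * indicator (A i) y)" for n
          by (rule sums) (use A union in auto)
      qed (use A in measurable)
    qed (auto simp: P_def atMost)
  qed
  \<comment> \<open>The approximating functions are at most twice as large in modulus as
    \<open>h\<close>, whence the uniform bound \<open>2 * C\<close> below.\<close>
  obtain U where U: "\<And>i. simple_function borel (U i)" "\<And>y. (\<lambda>i. U i y) \<longlonglongrightarrow> h y"
    "\<And>i y. dist (U i y) 0 \<le> 2 * dist (h y) 0"
    using borel_measurable_implies_sequence_metric[OF h, of 0] by auto
  have "P h"
  proof (rule lim[where U = U and K = "2 * C"])
    show "\<bar>U n y\<bar> \<le> 2 * C" for n y
      using U(3)[of n y] bound[of y] by simp
    show "P (U n)" for n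
    proof -
      have fin: "finite (range (U n))"
        using U(1) by (simp add: simple_function_def)
      have eq: "U n = (\<lambda>y. \<Sum>c\<in>range (U n). c * indicator (U n -` {c}) y)"
        by (rule ext, subst sum.remove[OF fin, of "U n _"]) (auto simp: indicator_def intro!: sum.neutral)
      have "P (\<lambda>y. \<Sum>c\<in>range (U n). c * indicator (U n -` {c}) y)"
      proof (rule sums[OF fin])
        show "U n -` {c} \<in> sets borel" for c
          using simple_functionD(2)[OF U(1), of n "{c}"] by simp
        then show "P (indicator (U n -` {c}))" for c
          by (rule sets)
      qed
      then show ?thesis by (subst eq)
    qed
  qed (use U h in \<open>auto intro: borel_measurable_simple_function\<close>)
  then show ?thesis by (simp add: P_def)
qed

section \<open>Functions with vanishing indefinite integral\<close>

lemma integral_indicator_atMost: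
  fixes f :: "real \<Rightarrow> real"
  assumes f: "f absolutely_integrable_on {a..b}"
  shows "(\<integral>s. indicator {..c} s * (indicator {a..b} s * f s) \<partial>lebesgue) = integral {a..min b c} f"
proof -
  have "f absolutely_integrable_on {a..min b c}"
    by (rule absolutely_integrable_on_subinterval[OF f]) auto
  then have "integral {a..min b c} f = (\<integral>s. indicator {a..min b c} s *\<^sub>R f s \<partial>lebesgue)"
    using set_lebesgue_integral_eq_integral(2) by (metis set_lebesgue_integral_def)
  also have "\<dots> = (\<integral>s. indicator {..c} s * (indicator {a..b} s * f s) \<partial>lebesgue)"
    by (rule Bochner_Integration.integral_cong) (auto simp: indicator_def)
  finally show ?thesis by simp
qed

text \<open>Comparison with the density 0, with the identity as both maps, shows that
  \<open>h * g\<close> has integral 0 for bounded Borel \<open>h\<close>. For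
  \<open>h = sgn \<circ> g'\<close>, with \<open>g'\<close> a Borel representative of
  \<open>g\<close>, this is the integral of the modulus of \<open>g\<close>.\<close>

lemma AE_zero_if_integral_zero:
  fixes f :: "real \<Rightarrow> real"
  assumes f: "f absolutely_integrable_on {a..b}"
    and zero: "\<And>t. t \<in> {a..b} \<Longrightarrow> integral {a..t} f = 0"
  shows "AE s in lebesgue. s \<in> {a..b} \<longrightarrow> f s = 0"
proof -
  define g where "g s = indicator {a..b} s * f s" for s
  have g: "integrable lebesgue g"
    using f by (simp add: set_integrable_def g_def[abs_def])
  then obtain g' where g': "g' \<in> borel_measurable lborel" "AE s in lborel. g s = g' s"
    using completion_ex_borel_measurable_real borel_measurable_integrable by blast
  have eq: "AE s in lebesgue. g s = g' s"
    using g'(2) by (rule AE_completion)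
  \<comment> \<open>For \<open>t < a\<close> the interval is empty, so every threshold
    \<open>min b c\<close> is covered.\<close>
  have zero': "integral {a..t} f = 0" if "t \<le> b" for t
    using zero[of t] that by (cases "a \<le> t") auto
  have int: "(\<integral>s. g s \<partial>lebesgue) = 0"
  proof -
    have "(\<integral>s. g s \<partial>lebesgue) = (\<integral>s. indicator {..b} s * (indicator {a..b} s * f s) \<partial>lebesgue)"
      by (rule Bochner_Integration.integral_cong) (auto simp: g_def indicator_def)
    then show ?thesis
      using integral_indicator_atMost[OF f, of b] zero'[of b] by simp
  qed
  have "(\<integral>s. sgn (g' s) * g s \<partial>lebesgue) = (\<integral>s. sgn (g' s) * 0 \<partial>(lebesgue :: real measure))"
  proof (rule integral_transport_eq[where X = "\<lambda>s. s" and Y = "\<lambda>s. s" and h = "\<lambda>y. sgn (g' y)" and C = 1])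
    show "(\<integral>s. indicator {..c} s * g s \<partial>lebesgue) = (\<integral>s. indicator {..c} s * 0 \<partial>(lebesgue :: real measure))" for c
      using integral_indicator_atMost[OF f, of c] zero'[of "min b c"] by (simp add: g_def)
    show "(\<lambda>y. sgn (g' y)) \<in> borel_measurable borel"
      using g'(1) by simp
  qed (auto simp: int g sgn_if intro: measurable_completion)
  moreover have "(\<integral>s. sgn (g' s) * g s \<partial>lebesgue) = (\<integral>s. \<bar>g s\<bar> \<partial>lebesgue)"
  proof (rule integral_cong_AE)
    have "g' \<in> borel_measurable lebesgue"
      using g'(1) by (rule measurable_completion)
    then show "(\<lambda>s. sgn (g' s) * g s) \<in> borel_measurable lebesgue"
      using g by (intro borel_measurable_times measurable_compose[OF _ borel_measurable_sgn]) auto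
    show "AE s in lebesgue. sgn (g' s) * g s = \<bar>g s\<bar>"
      using eq by eventually_elim (auto simp: sgn_if)
  qed (use g in auto)
  ultimately have "(\<integral>s. \<bar>g s\<bar> \<partial>lebesgue) = 0" by simp
  then have "AE s in lebesgue. \<bar>g s\<bar> = 0"
    using g by (subst (asm) integral_nonneg_eq_0_iff_AE) auto
  then show ?thesis
    by eventually_elim (auto simp: g_def)
qed

section \<open>Integrals over oriented intervals\<close>

lemma interval_lebesgue_integral_eq_integral:
  fixes f :: "real \<Rightarrow> real"
  assumes "a \<le> b" "f absolutely_integrable_on {a..b}"
  shows "(LINT s=a..b|lebesgue. f s) = integral {a..b} f"
proof -
  have f: "f absolutely_integrable_on {a<..<b}"
    using assms absolutely_integrable_on_Icc_iff_Ioo by blast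
  have "(LINT s=a..b|lebesgue. f s) = (LINT s:{a<..<b}|lebesgue. f s)"
    using assms by (simp add: interval_lebesgue_integral_def)
  also have "\<dots> = integral {a<..<b} f"
    using f by (rule set_lebesgue_integral_eq_integral)
  also have "\<dots> = integral {a..b} f"
    using integral_open_interval[of a b f] by simp
  finally show ?thesis .
qed

lemma interval_lebesgue_integral_reverse:
  fixes f :: "real \<Rightarrow> real" and a b :: real
  shows "(LINT s=b..a|lebesgue. f s) = - (LINT s=a..b|lebesgue. f s)"
  by (cases a b rule: linorder_cases)
     (auto simp: interval_lebesgue_integral_def einterval_same set_lebesgue_integral_def)

text \<open>Weighting by \<open>orient a b\<close> turns an integral over an oriented interval into an ordinary integral, so that
  it can serve as one side of \<open>integral_transport_eq\<close>.\<close>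

definition orient :: "real \<Rightarrow> real \<Rightarrow> real \<Rightarrow> real" where
  "orient a b y = indicator {a<..<b} y - indicator {b<..<a} y"

lemma interval_lebesgue_integral_orient:
  "(LINT y=a..b|lebesgue. f y) = (\<integral>y. f y * orient a b y \<partial>lebesgue)" for a b :: real and f :: "real \<Rightarrow> real"
  by (cases a b rule: linorder_cases)
     (auto simp: interval_lebesgue_integral_def set_lebesgue_integral_def orient_def mult.commute einterval_same
       simp flip: Bochner_Integration.integral_minus)

lemma integrable_orient: "integrable lebesgue (orient a b)"
proof -
  have "integrable lebesgue (indicat_real {a<..<b})" for a b :: real
    by (cases "a \<le> b") (auto simp: integrable_indicator_iff)
  then show ?thesis
    unfolding orient_def[abs_def] by (intro Bochner_Integration.integrable_diff)
qed

section \<open>Substitution with a continuous integrand\<close>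

lemma local_to_global_bound:
  fixes D W :: "real \<Rightarrow> real"
  assumes "a \<le> b" "\<delta> > 0"
    and loc: "\<And>s t. a \<le> s \<Longrightarrow> s \<le> t \<Longrightarrow> t \<le> b \<Longrightarrow> t - s < \<delta> \<Longrightarrow> \<bar>D t - D s\<bar> \<le> W t - W s"
  shows "\<bar>D b - D a\<bar> \<le> W b - W a"
proof -
  \<comment> \<open>Induction on the number of steps of length \<open>\<delta> / 2\<close>; halving
    keeps each step strictly shorter than \<open>\<delta>\<close>. Since the bounds are increments
    of one function \<open>W\<close>, they telescope.\<close>
  have "\<bar>D t - D a\<bar> \<le> W t - W a" if "a \<le> t" "t \<le> b" "t - a < real (Suc n) * (\<delta> / 2)" for n t
    using that
  proof (induction n arbitrary: t)
    case 0
    then show ?case using loc[of a t] \<open>\<delta> > 0\<close> by simp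
  next
    case (Suc n)
    define s where "s = max a (t - \<delta> / 2)"
    have "0 < \<delta> + \<delta> * real n"
      using \<open>\<delta> > 0\<close> by (simp add: add_pos_nonneg)
    then have "\<bar>D s - D a\<bar> \<le> W s - W a"
      using Suc.prems \<open>\<delta> > 0\<close> by (intro Suc.IH) (auto simp: s_def field_simps max_def)
    moreover have "\<bar>D t - D s\<bar> \<le> W t - W s"
      using Suc.prems \<open>\<delta> > 0\<close> by (intro loc) (auto simp: s_def)
    ultimately show ?case by linarith
  qed
  moreover obtain n where "(b - a) / (\<delta> / 2) < real n"
    using reals_Archimedean2 by blast
  then have "b - a < real (Suc n) * (\<delta> / 2)"
    using \<open>\<delta> > 0\<close> by (simp add: field_simps)
  ultimately show ?thesis using \<open>a \<le> b\<close> by blast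
qed

text \<open>Measuring both endpoints from a point \<open>p\<close> to their left treats both
  orientations at once.\<close>

lemma interval_lebesgue_integral_eq_diff:
  fixes f :: "real \<Rightarrow> real"
  assumes f: "f absolutely_integrable_on {p..q}" and "u \<in> {p..q}" "w \<in> {p..q}"
  shows "(LINT y=u..w|lebesgue. f y) = integral {p..w} f - integral {p..u} f"
proof -
  have *: "(LINT y=u..w|lebesgue. f y) = integral {p..w} f - integral {p..u} f"
    if "u \<le> w" "u \<in> {p..q}" "w \<in> {p..q}" for u w
  proof -
    have "f absolutely_integrable_on {u..w}" "f absolutely_integrable_on {p..w}"
      by (rule absolutely_integrable_on_subinterval[OF f]; use that in auto)+
    then show ?thesis
      using that Henstock_Kurzweil_Integration.integral_combine[of p u w f]
      by (simp add: interval_lebesgue_integral_eq_integral absolutely_integrable_on_def)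
  qed
  show ?thesis
    using *[of u w] *[of w u] assms(2,3) interval_lebesgue_integral_reverse[of w u f]
    by (cases "u \<le> w") auto
qed

text \<open>Here \<open>h\<close> has to be Borel: a merely Lebesgue measurable function composed
  with a continuous one need not be measurable. This is why Borel representatives are taken
  throughout.\<close>

lemma absolutely_integrable_bounded_comp:
  fixes h X g :: "real \<Rightarrow> real"
  assumes X: "continuous_on {a..b} X" and h: "h \<in> borel_measurable borel"
    and bound: "\<And>y. y \<in> X ` {a..b} \<Longrightarrow> \<bar>h y\<bar> \<le> C" and g: "g absolutely_integrable_on {a..b}"
  shows "(\<lambda>s. h (X s) * g s) absolutely_integrable_on {a..b}"
proof (rule absolutely_integrable_bounded_measurable_product_real[OF _ _ _ g])
  have "X \<in> borel_measurable (lebesgue_on {a..b})"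
    using X by (rule continuous_imp_measurable_on_sets_lebesgue) auto
  then show "(\<lambda>s. h (X s)) \<in> borel_measurable (lebesgue_on {a..b})"
    using h by (rule measurable_compose)
  show "bounded ((\<lambda>s. h (X s)) ` {a..b})"
    using bound by (auto simp: bounded_iff)
qed auto

lemma indefinite_integral_continuous:
  fixes g X :: "real \<Rightarrow> real"
  assumes "g absolutely_integrable_on {a..b}"
    and X: "\<And>t. t \<in> {a..b} \<Longrightarrow> X t = X a + integral {a..t} g"
  shows "continuous_on {a..b} X"
proof -
  have "continuous_on {a..b} (\<lambda>t. X a + integral {a..t} g)"
    using assms(1) by (intro continuous_intros indefinite_integral_continuous_1) (simp add: absolutely_integrable_on_def)
  then show ?thesis
    by (subst continuous_on_cong[OF refl X])
qed

text \<open>The intermediate point of the mean value theorem lies between \<open>X s\<close> and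
  \<open>X t\<close>, and the path attains it because its image is connected. Expressing it as
  \<open>X r\<close> lets uniform continuity in time control \<open>h\<close> there.\<close>

lemma mean_value_along_path:
  fixes H h X :: "real \<Rightarrow> real"
  assumes "s \<le> t" and X: "continuous_on {s..t} X" and sub: "X ` {s..t} \<subseteq> S"
    and H: "\<And>y. y \<in> S \<Longrightarrow> (H has_real_derivative h y) (at y within S)"
  shows "\<exists>r\<in>{s..t}. H (X t) - H (X s) = h (X r) * (X t - X s)"
proof -
  have seg: "closed_segment (X s) (X t) \<subseteq> X ` {s..t}"
  proof -
    have "connected (X ` {s..t})"
      using X by (rule connected_continuous_image) simp
    then have "{X s..X t} \<subseteq> X ` {s..t}" "{X t..X s} \<subseteq> X ` {s..t}"
      by (rule connected_contains_Icc; use \<open>s \<le> t\<close> in simp)+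
    then show ?thesis by (simp add: closed_segment_eq_real_ivl)
  qed
  have mv: "\<exists>y\<in>closed_segment u w. H w - H u = h y * (w - u)"
    if "u < w" "closed_segment u w \<subseteq> S" for u w
  proof -
    have "(H has_derivative (\<lambda>x. h y * x)) (at y within {u..w})" if "u \<le> y" "y \<le> w" for y
    proof -
      have "{u..w} \<subseteq> S"
        using \<open>closed_segment u w \<subseteq> S\<close> \<open>u < w\<close> by (simp add: closed_segment_eq_real_ivl)
      moreover from this have "(H has_derivative (\<lambda>x. h y * x)) (at y within S)"
        using H[of y] that by (auto simp: has_field_derivative_def)
      ultimately show ?thesis by (meson has_derivative_subset)
    qed
    then obtain y where "y \<in> {u<..<w}" "H w - H u = h y * (w - u)"
      using mvt_simple[OF \<open>u < w\<close>, of H "\<lambda>y x. h y * x"] by auto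
    then show ?thesis
      using \<open>u < w\<close> by (intro bexI[of _ y]) (auto simp: closed_segment_eq_real_ivl)
  qed
  consider "X s < X t" | "X t < X s" | "X s = X t" by linarith
  then show ?thesis
  proof cases
    case 1
    then show ?thesis using mv[of "X s" "X t"] seg sub by fastforce
  next
    case 2
    then obtain y where "y \<in> closed_segment (X s) (X t)" and y: "H (X s) - H (X t) = h y * (X s - X t)"
      using mv[of "X t" "X s"] seg sub by (auto simp: closed_segment_commute)
    then obtain r where "r \<in> {s..t}" "y = X r" using seg by blast
    then show ?thesis
      using y by (intro bexI[of _ r]) (auto simp: algebra_simps)
  next
    case 3
    then show ?thesis using \<open>s \<le> t\<close> by auto
  qed
qed

text \<open>Over a short interval the defect \<open>D\<close> changes by the integral of
  \<open>(h (X r) - h (X u)) * g u\<close>, with \<open>r\<close> from the mean value theorem, hence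
  by at most \<open>e\<close> times the integral of the modulus of \<open>g\<close>. These bounds
  add up, so the total change is at most \<open>e\<close> times a constant for every
  \<open>e > 0\<close>.\<close>

lemma ac_substitution_continuous:
  fixes g X h :: "real \<Rightarrow> real"
  assumes "a \<le> b" and g: "g absolutely_integrable_on {a..b}"
    and X: "\<And>t. t \<in> {a..b} \<Longrightarrow> X t = X a + integral {a..t} g"
    and h: "continuous_on UNIV h"
  shows "(LINT y=X a..X b|lebesgue. h y) = integral {a..b} (\<lambda>s. h (X s) * g s)"
proof -
  have contX: "continuous_on {a..b} X"
    using g X by (rule indefinite_integral_continuous)
  have conthX: "continuous_on {a..b} (\<lambda>s. h (X s))"
    using continuous_on_compose2[OF h contX] by simp
  obtain p q where pq: "X ` {a..b} \<subseteq> {p..q}"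
    using compact_imp_bounded[OF compact_continuous_image[OF contX compact_Icc]] bounded_subset_cbox_symmetric
    by (metis cbox_interval)
  obtain C where C: "\<And>y. y \<in> X ` {a..b} \<Longrightarrow> \<bar>h y\<bar> \<le> C"
    using compact_imp_bounded[OF compact_continuous_image[OF conthX compact_Icc]]
    by (auto simp: bounded_iff)
  have hg: "(\<lambda>s. h (X s) * g s) absolutely_integrable_on {a..b}"
    using contX borel_measurable_continuous_onI[OF h] C g by (rule absolutely_integrable_bounded_comp)
  define H where "H y = integral {p..y} h" for y
  have H: "(H has_real_derivative h y) (at y within {p..q})" if "y \<in> {p..q}" for y
    unfolding H_def[abs_def] using that continuous_on_subset[OF h]
    by (intro integral_has_real_derivative) auto
  define D where "D t = H (X t) - integral {a..t} (\<lambda>s. h (X s) * g s)" for t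
  have sub: "f integrable_on {s..t}" "integral {a..t} f - integral {a..s} f = integral {s..t} f"
    if "f absolutely_integrable_on {a..b}" "a \<le> s" "s \<le> t" "t \<le> b" for f :: "real \<Rightarrow> real" and s t
  proof -
    have "f absolutely_integrable_on {s..t}" "f absolutely_integrable_on {a..t}"
      by (rule absolutely_integrable_on_subinterval[OF that(1)]; use that in auto)+
    then show "f integrable_on {s..t}" "integral {a..t} f - integral {a..s} f = integral {s..t} f"
      using that Henstock_Kurzweil_Integration.integral_combine[of a s t f]
      by (auto simp: absolutely_integrable_on_def)
  qed
  have absg: "(\<lambda>s. \<bar>g s\<bar>) absolutely_integrable_on {a..b}"
    using set_integrable_abs[OF g] by simp
  have "\<bar>D b - D a\<bar> \<le> e * integral {a..b} (\<lambda>s. \<bar>g s\<bar>)" if "e > 0" for e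
  proof -
    obtain d where "d > 0"
      and d: "\<And>r s. r \<in> {a..b} \<Longrightarrow> s \<in> {a..b} \<Longrightarrow> \<bar>r - s\<bar> < d \<Longrightarrow> \<bar>h (X r) - h (X s)\<bar> < e"
    proof -
      have "uniformly_continuous_on {a..b} (\<lambda>s. h (X s))"
        using conthX compact_Icc by (rule compact_uniformly_continuous)
      then obtain d where "d > 0"
        "\<forall>s\<in>{a..b}. \<forall>r\<in>{a..b}. dist r s < d \<longrightarrow> dist (h (X r)) (h (X s)) < e"
        using \<open>e > 0\<close> unfolding uniformly_continuous_on_def by blast
      then show thesis
        by (intro that[of d]) (auto simp: dist_real_def)
    qed
    have "\<bar>D t - D s\<bar> \<le> e * integral {a..t} (\<lambda>s. \<bar>g s\<bar>) - e * integral {a..s} (\<lambda>s. \<bar>g s\<bar>)"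
      if st: "a \<le> s" "s \<le> t" "t \<le> b" "t - s < d" for s t
    proof -
      have "continuous_on {s..t} X"
        by (rule continuous_on_subset[OF contX]) (use st in auto)
      moreover have "X ` {s..t} \<subseteq> {p..q}"
        using pq st by (auto simp: image_subset_iff)
      ultimately obtain r where r: "r \<in> {s..t}" "H (X t) - H (X s) = h (X r) * (X t - X s)"
        using mean_value_along_path[OF \<open>s \<le> t\<close> _ _ H] by blast
      have "X t - X s = integral {s..t} g"
        using sub(2)[OF g, of s t] X[of s] X[of t] st by simp
      then have "D t - D s = h (X r) * integral {s..t} g - integral {s..t} (\<lambda>s. h (X s) * g s)"
        using sub(2)[OF hg, of s t] st r(2) by (simp add: D_def)
      also have "\<dots> = integral {s..t} (\<lambda>u. h (X r) * g u - h (X u) * g u)"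
        using sub(1)[OF g, of s t] sub(1)[OF hg, of s t] st
        by (subst Henstock_Kurzweil_Integration.integral_diff) (auto intro: integrable_on_mult_right)
      finally have "\<bar>D t - D s\<bar> = norm (integral {s..t} (\<lambda>u. h (X r) * g u - h (X u) * g u))"
        by simp
      also have "\<dots> \<le> integral {s..t} (\<lambda>u. e * \<bar>g u\<bar>)"
      proof (rule integral_norm_bound_integral)
        show "(\<lambda>u. h (X r) * g u - h (X u) * g u) integrable_on {s..t}"
          using sub(1)[OF g, of s t] sub(1)[OF hg, of s t] st
          by (intro integrable_diff) (auto intro: integrable_on_mult_right)
        show "(\<lambda>u. e * \<bar>g u\<bar>) integrable_on {s..t}"
          using sub(1)[OF absg, of s t] st by (auto intro: integrable_on_mult_right)
        show "norm (h (X r) * g u - h (X u) * g u) \<le> e * \<bar>g u\<bar>" if "u \<in> {s..t}" for u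
        proof -
          have "\<bar>h (X r) - h (X u)\<bar> < e"
            by (rule d) (use r(1) that st in auto)
          then show ?thesis
            by (auto simp: abs_mult left_diff_distrib[symmetric] intro!: mult_right_mono)
        qed
      qed
      also have "\<dots> = e * integral {a..t} (\<lambda>s. \<bar>g s\<bar>) - e * integral {a..s} (\<lambda>s. \<bar>g s\<bar>)"
        using sub(2)[OF absg, of s t] st by (simp flip: right_diff_distrib)
      finally show ?thesis .
    qed
    then show ?thesis
      using local_to_global_bound[OF \<open>a \<le> b\<close> \<open>d > 0\<close>,
          of D "\<lambda>t. e * integral {a..t} (\<lambda>s. \<bar>g s\<bar>)"]
      by simp
  qed
  note small = this
  have "\<bar>D b - D a\<bar> \<le> 0"
  proof (rule field_le_epsilon)
    fix e :: real assume "e > 0"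
    define K where "K = integral {a..b} (\<lambda>s. \<bar>g s\<bar>)"
    \<comment> \<open>Dividing by \<open>\<bar>K\<bar> + 1\<close> rather than by \<open>K\<close>
      also covers \<open>K = 0\<close>.\<close>
    have "\<bar>D b - D a\<bar> \<le> e / (\<bar>K\<bar> + 1) * K"
      unfolding K_def using \<open>e > 0\<close> by (intro small) (simp add: add_nonneg_pos)
    also have "\<dots> \<le> 0 + e"
      using \<open>e > 0\<close> by (simp add: field_simps abs_if)
    finally show "\<bar>D b - D a\<bar> \<le> 0 + e" .
  qed
  then have "H (X b) - H (X a) = integral {a..b} (\<lambda>s. h (X s) * g s)"
    by (simp add: D_def)
  moreover have "(LINT y=X a..X b|lebesgue. h y) = H (X b) - H (X a)"
    unfolding H_def using \<open>a \<le> b\<close> pq[THEN subsetD, of "X a"] pq[THEN subsetD, of "X b"]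
      continuous_on_subset[OF h]
    by (intro interval_lebesgue_integral_eq_diff[where q = q] absolutely_integrable_continuous_real) auto
  ultimately show ?thesis by simp
qed

section \<open>Substitution with a Borel integrand, and preimages of null sets\<close>

lemma ac_substitution_borel:
  fixes g X h :: "real \<Rightarrow> real"
  assumes "a \<le> b" and g: "g absolutely_integrable_on {a..b}"
    and X: "\<And>t. t \<in> {a..b} \<Longrightarrow> X t = X a + integral {a..t} g"
    and h: "h \<in> borel_measurable borel" and bound: "\<And>y. \<bar>h y\<bar> \<le> C"
  shows "(LINT y=X a..X b|lebesgue. h y) = integral {a..b} (\<lambda>s. h (X s) * g s)"
proof -
  let ?M = "lebesgue_on {a..b}"
  have contX: "continuous_on {a..b} X"
    using g X by (rule indefinite_integral_continuous)
  then have measX [measurable]: "X \<in> borel_measurable ?M"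
    by (rule continuous_imp_measurable_on_sets_lebesgue) auto
  have gM: "integrable ?M g"
    using g by (rule absolutely_integrable_imp_integrable) auto
  have [measurable]: "g \<in> borel_measurable ?M"
    using gM by auto
  have [measurable]: "orient (X a) (X b) \<in> borel_measurable lebesgue"
    using integrable_orient by auto
  have id [measurable]: "(\<lambda>y. y) \<in> borel_measurable (lebesgue :: real measure)"
    by (rule measurable_completion) simp
  have to_M: "integral {a..b} (\<lambda>s. u (X s) * g s) = (\<integral>s. u (X s) * g s \<partial>?M)"
    if "u \<in> borel_measurable borel" "\<And>y. \<bar>u y\<bar> \<le> K" for u K
    using lebesgue_integral_eq_integral[OF absolutely_integrable_imp_integrable[OF
        absolutely_integrable_bounded_comp[OF contX that g]]]
    by simp
  have cont: "(\<integral>s. u (X s) * g s \<partial>?M) = (\<integral>y. u y * orient (X a) (X b) y \<partial>lebesgue)"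
    if "continuous_on UNIV u" "\<And>y. \<bar>u y\<bar> \<le> K" for u K
    using ac_substitution_continuous[OF \<open>a \<le> b\<close> g X that(1)]
      to_M[OF borel_measurable_continuous_onI[OF that(1)] that(2)]
    by (simp add: interval_lebesgue_integral_orient)
  \<comment> \<open>On the image side the map is the identity and the density is
    \<open>orient (X a) (X b)\<close>. Only the total and the half-lines remain to be compared, and
    both reduce to continuous integrands.\<close>
  have "(\<integral>s. h (X s) * g s \<partial>?M) = (\<integral>y. h y * orient (X a) (X b) y \<partial>lebesgue)"
  proof (rule integral_transport_eq[OF measX id gM integrable_orient _ _ h bound])
    show "(\<integral>s. g s \<partial>?M) = (\<integral>y. orient (X a) (X b) y \<partial>lebesgue)"
      using cont[of "\<lambda>_. 1" 1] by simp
    fix c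
    \<comment> \<open>Continuous ramps: \<open>u n\<close> is 1 up to \<open>c\<close> and, for
      \<open>n > 0\<close>, falls linearly to 0 at \<open>c + 1 / n\<close>. The value 1 at
      \<open>c\<close> itself matches the closed half-line.\<close>
    define u where "u n y = max 0 (min 1 (1 - real n * (y - c)))" for n y
    have cu: "continuous_on UNIV (u n)" for n
      unfolding u_def by (intro continuous_intros)
    have [measurable]: "u n \<in> borel_measurable borel" for n
      using cu by (rule borel_measurable_continuous_onI)
    have u1: "\<bar>u n y\<bar> \<le> 1" for n y
      by (simp add: u_def)
    have lim: "(\<lambda>n. u n y) \<longlonglongrightarrow> indicator {..c} y" for y
    proof (cases "y \<le> c")
      case True
      then have "u n y = 1" for n
        by (simp add: u_def mult_nonneg_nonpos)
      then show ?thesis using True by simp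
    next
      case False
      then obtain N where N: "1 < real N * (y - c)"
        using reals_Archimedean3[of "y - c"] by auto
      have "1 < real n * (y - c)" if "N \<le> n" for n
        using N mult_right_mono[of "real N" "real n" "y - c"] that False by linarith
      then have "eventually (\<lambda>n. 1 < real n * (y - c)) sequentially"
        by (rule eventually_sequentiallyI)
      then have "eventually (\<lambda>n. u n y = 0) sequentially"
        by eventually_elim (simp add: u_def)
      then show ?thesis
        using False by (simp add: tendsto_eventually)
    qed
    have "(\<lambda>n. \<integral>s. u n (X s) * g s \<partial>?M) \<longlonglongrightarrow> (\<integral>s. indicator {..c} (X s) * g s \<partial>?M)"
      by (rule integral_dominated_convergence[where w = "\<lambda>s. \<bar>g s\<bar>"])
         (auto intro!: tendsto_intros lim u1 mult_left_le_one_le integrable_abs gM simp: abs_mult)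
    moreover have "(\<lambda>n. \<integral>y. u n y * orient (X a) (X b) y \<partial>lebesgue)
      \<longlonglongrightarrow> (\<integral>y. indicator {..c} y * orient (X a) (X b) y \<partial>lebesgue)"
      by (rule integral_dominated_convergence[where w = "\<lambda>y. \<bar>orient (X a) (X b) y\<bar>"])
         (auto intro!: tendsto_intros lim u1 mult_left_le_one_le integrable_abs integrable_orient simp: abs_mult)
    ultimately show "(\<integral>s. indicator {..c} (X s) * g s \<partial>?M)
      = (\<integral>y. indicator {..c} y * orient (X a) (X b) y \<partial>lebesgue)"
      using cont[OF cu u1] by (simp add: LIMSEQ_unique)
  qed
  then show ?thesis
    using to_M[OF h bound] by (simp add: interval_lebesgue_integral_orient)
qed

text \<open>Substituting the indicator of \<open>B\<close> gives 0 on the image side, so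
  \<open>indicator B (X s) * g s\<close> has integral 0 over every \<open>{a..t}\<close>. The set of
  times with \<open>X s\<close> in \<open>B\<close> may still have positive measure. Being null for
  \<open>lborel\<close> includes being Borel.\<close>

lemma ac_deriv_zero_on_null_preimage:
  fixes g X :: "real \<Rightarrow> real"
  assumes g: "g absolutely_integrable_on {a..b}"
    and X: "\<And>t. t \<in> {a..b} \<Longrightarrow> X t = X a + integral {a..t} g"
    and B: "B \<in> null_sets lborel"
  shows "AE s in lebesgue. s \<in> {a..b} \<longrightarrow> X s \<in> B \<longrightarrow> g s = 0"
proof -
  have contX: "continuous_on {a..b} X"
    using g X by (rule indefinite_integral_continuous)
  have ind: "indicat_real B \<in> borel_measurable borel"
    using B by auto
  have "AE s in lebesgue. s \<in> {a..b} \<longrightarrow> indicator B (X s) * g s = 0"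
  proof (rule AE_zero_if_integral_zero)
    show "(\<lambda>s. indicator B (X s) * g s) absolutely_integrable_on {a..b}"
      using contX ind _ g by (rule absolutely_integrable_bounded_comp[where C = 1]) (simp add: indicator_def)
    fix t assume t: "t \<in> {a..b}"
    have "AE y in lebesgue. y \<notin> B"
      using B by (intro AE_completion AE_not_in)
    then have "AE y in lebesgue. indicator B y * orient (X a) (X t) y = 0"
      by eventually_elim simp
    then have "(\<integral>y. indicator B y * orient (X a) (X t) y \<partial>lebesgue) = 0"
      by (rule integral_eq_zero_AE)
    moreover have "(LINT y=X a..X t|lebesgue. indicator B y) = integral {a..t} (\<lambda>s. indicator B (X s) * g s)"
    proof (rule ac_substitution_borel[OF _ _ _ ind, where C = 1])
      show "g absolutely_integrable_on {a..t}"
        by (rule absolutely_integrable_on_subinterval[OF g]) (use t in auto)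
      show "X u = X a + integral {a..u} g" if "u \<in> {a..t}" for u
        by (rule X) (use that t in auto)
    qed (use t in \<open>auto simp: indicator_def\<close>)
    ultimately show "integral {a..t} (\<lambda>s. indicator B (X s) * g s) = 0"
      by (simp add: interval_lebesgue_integral_orient)
  qed
  then show ?thesis
    by eventually_elim (auto simp: indicator_def split: if_splits)
qed

section \<open>Changes on null sets\<close>

lemma AE_lebesgue_negligible:
  assumes "AE s in lebesgue. P s"
  shows "negligible {s. \<not> P s}"
  using assms by (simp add: negligible_iff_null_sets completion.AE_iff_null_sets)

lemma integral_cong_AE_lebesgue:
  fixes f g :: "real \<Rightarrow> real"
  assumes "AE s in lebesgue. s \<in> S \<longrightarrow> f s = g s"
  shows "integral S f = integral S g"
  by (rule integral_spike[OF AE_lebesgue_negligible[OF assms]]) auto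

lemma absolutely_integrable_cong_AE_lebesgue:
  fixes f g :: "real \<Rightarrow> real"
  assumes "AE s in lebesgue. s \<in> S \<longrightarrow> f s = g s" "f absolutely_integrable_on S"
  shows "g absolutely_integrable_on S"
  by (rule absolutely_integrable_spike[OF assms(2) AE_lebesgue_negligible[OF assms(1)]]) auto

section \<open>The data \<open>v\<close> and \<open>\<lambda>\<close>\<close>

lemma Linf_ge_borel_representative:
  assumes v: "v \<in> Linf_ge m"
  obtains v' C B where "v' \<in> borel_measurable borel" "\<And>y. m \<le> v' y" "\<And>y. v' y \<le> C"
    "B \<in> null_sets lborel" "\<And>y. y \<notin> B \<Longrightarrow> v' y = v y"
proof -
  have "v \<in> borel_measurable lebesgue" and m: "\<And>y. m \<le> v y"
    using v by (auto simp: Linf_ge_def Linf_def)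
  then obtain w where w: "w \<in> borel_measurable lborel" "AE y in lborel. v y = w y"
    using completion_ex_borel_measurable_real by blast
  obtain C where "AE y in lebesgue. \<bar>v y\<bar> \<le> C"
    using v by (auto simp: Linf_ge_def Linf_def)
  then have "AE y in lborel. \<bar>v y\<bar> \<le> C"
    by (simp add: AE_completion_iff)
  \<comment> \<open>Clipping makes both bounds hold everywhere and alters \<open>w\<close> only on a
    null set. The upper level \<open>max m C\<close> is at least \<open>m\<close> whatever the sign
    or size of \<open>C\<close>.\<close>
  define v' where "v' y = max m (min (max m C) (w y))" for y
  have "AE y in lborel. v' y = v y"
    using w(2) \<open>AE y in lborel. \<bar>v y\<bar> \<le> C\<close>
  proof eventually_elim
    case (elim y)
    then show ?case using m[of y] by (auto simp: v'_def)
  qed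
  then obtain B where "B \<in> null_sets lborel" "{y \<in> space lborel. v' y \<noteq> v y} \<subseteq> B"
    unfolding eventually_ae_filter by blast
  moreover have "v' \<in> borel_measurable borel"
    unfolding v'_def using w(1) by simp
  ultimately show thesis
    by (intro that[of v' "max m C" B]) (auto simp: v'_def)
qed

text \<open>\<open>F\<close> has slope at least \<open>1 / C\<close>, so it is an increasing
  bijection, and its inverse \<open>G\<close> is monotone and hence Borel. Substitution along
  \<open>F\<close> turns the integrand \<open>w \<circ> G\<close> into
  \<open>w s * (1 / w s) = 1\<close>, which makes \<open>G\<close> an antiderivative of
  \<open>w \<circ> G\<close>.\<close>

lemma antiderivative_reciprocal_inverse:
  fixes w :: "real \<Rightarrow> real" and x0 :: real
  assumes w: "w \<in> borel_measurable borel" and "m > 0" and lower: "\<And>y. m \<le> w y" and upper: "\<And>y. w y \<le> C"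
  defines "F \<equiv> \<lambda>z::real. (LINT y=x0..z|lebesgue. (1 / w y))"
  obtains G where "G \<in> borel_measurable borel" "\<And>z. G (F z) = z"
    "\<And>p q. (LINT u=F p..F q|lebesgue. w (G u)) = q - p"
proof -
  have pos: "w y > 0" for y using lower[of y] \<open>m > 0\<close> by linarith
  have "C > 0" using pos[of 0] upper[of 0] by linarith
  have abs_int: "(\<lambda>y. 1 / w y) absolutely_integrable_on {p..q}" for p q
  proof -
    have "(\<lambda>s. 1 / w s * 1) absolutely_integrable_on {p..q}"
      by (rule absolutely_integrable_bounded_comp[where X = "\<lambda>s. s" and h = "\<lambda>y. 1 / w y" and C = "1 / m"])
         (use w lower pos \<open>m > 0\<close> in \<open>auto simp: frac_le abs_of_pos\<close>)
    then show ?thesis by simp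
  qed
  have F_diff: "F q = F p + integral {p..q} (\<lambda>y. 1 / w y)" if "p \<le> q" for p q
  proof -
    \<comment> \<open>One interval containing \<open>x0\<close>, \<open>p\<close> and
      \<open>q\<close> writes all three oriented integrals as differences from the same base point
      \<open>P\<close>.\<close>
    define P Q where "P = min p x0" and "Q = max q x0"
    have "(LINT y=u..z|lebesgue. (1 / w y)) = integral {P..z} (\<lambda>y. 1 / w y) - integral {P..u} (\<lambda>y. 1 / w y)"
      if "u \<in> {P..Q}" "z \<in> {P..Q}" for u z
      using abs_int that by (rule interval_lebesgue_integral_eq_diff)
    from this[of x0 p] this[of x0 q] this[of p q] show ?thesis
      using \<open>p \<le> q\<close> interval_lebesgue_integral_eq_integral[OF \<open>p \<le> q\<close> abs_int]
      by (simp add: F_def P_def Q_def)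
  qed
  have F_lower: "(q - p) / C \<le> F q - F p" if "p \<le> q" for p q
  proof -
    have "integral {p..q} (\<lambda>y. 1 / C) \<le> integral {p..q} (\<lambda>y. 1 / w y)"
      using abs_int upper pos by (intro integral_le) (auto simp: absolutely_integrable_on_def frac_le)
    then show ?thesis using F_diff[OF that] that by simp
  qed
  have mono: "strict_mono F"
  proof (rule strict_monoI)
    fix p q :: real assume "p < q"
    then have "0 < (q - p) / C" using \<open>C > 0\<close> by simp
    then show "F p < F q" using F_lower[of p q] \<open>p < q\<close> by linarith
  qed
  have cont: "continuous_on {p..q} F" for p q
    by (rule indefinite_integral_continuous[OF abs_int]) (use F_diff in auto)
  have "F x0 = 0"
    by (simp add: F_def interval_lebesgue_integral_def einterval_same set_lebesgue_integral_def)
  have "\<exists>z. F z = u" for u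
  proof -
    \<comment> \<open>Starting from 0 at \<open>x0\<close> with slope at least \<open>1 / C\<close>,
      \<open>F\<close> moves by at least \<open>\<bar>u\<bar>\<close> over the distance
      \<open>d\<close>, so \<open>u\<close> is bracketed.\<close>
    define d where "d = C * \<bar>u\<bar>"
    have "d \<ge> 0" using \<open>C > 0\<close> by (simp add: d_def)
    have "\<bar>u\<bar> \<le> F (x0 + d)" "F (x0 - d) \<le> - \<bar>u\<bar>"
      using F_lower[of x0 "x0 + d"] F_lower[of "x0 - d" x0] \<open>d \<ge> 0\<close> \<open>C > 0\<close> \<open>F x0 = 0\<close>
      by (auto simp: d_def)
    then have "F (x0 - d) \<le> u" "u \<le> F (x0 + d)" by linarith+
    from IVT'[OF this _ cont] show ?thesis using \<open>d \<ge> 0\<close> by auto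
  qed
  then have "surj F" by (metis surjI)
  define G where "G = inv F"
  have GF: "G (F z) = z" for z
    unfolding G_def using strict_mono_imp_inj_on[OF mono] by (rule inv_f_f)
  have FG: "F (G u) = u" for u
    unfolding G_def using \<open>surj F\<close> by (rule surj_f_inv_f)
  have "G u \<le> G u'" if "u \<le> u'" for u u'
    using that FG strict_mono_less_eq[OF mono, of "G u" "G u'"] by simp
  then have "mono G" by (rule monoI)
  then have G: "G \<in> borel_measurable borel" by (rule borel_measurable_mono)
  have *: "(LINT u=F p..F q|lebesgue. w (G u)) = q - p" if "p \<le> q" for p q
  proof -
    have "(LINT u=F p..F q|lebesgue. w (G u)) = integral {p..q} (\<lambda>s. w (G (F s)) * (1 / w s))"
    proof (rule ac_substitution_borel[OF that abs_int])
      show "(\<lambda>u. w (G u)) \<in> borel_measurable borel" using w G by simp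
      show "\<bar>w (G u)\<bar> \<le> C" for u using upper[of "G u"] pos[of "G u"] by simp
    qed (use F_diff in auto)
    also have "\<dots> = integral {p..q} (\<lambda>s. 1)"
      using pos by (intro Henstock_Kurzweil_Integration.integral_cong) (simp add: GF less_imp_neq[symmetric])
    also have "\<dots> = q - p" using that by simp
    finally show ?thesis .
  qed
  have "(LINT u=F p..F q|lebesgue. w (G u)) = q - p" for p q
    using *[of p q] *[of q p] interval_lebesgue_integral_reverse[of "F p" "F q" "\<lambda>u. w (G u)"]
    by (cases "p \<le> q") auto
  with G GF show thesis by (rule that)
qed

section \<open>Evaluation of a Bochner coefficient along a continuous path\<close>

lemma ennreal_abs_le_Linf_norm:
  assumes f: "continuous_on UNIV f"
  shows "ennreal \<bar>f y\<bar> \<le> Linf_norm f"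
proof (rule ccontr)
  assume "\<not> ennreal \<bar>f y\<bar> \<le> Linf_norm f"
  \<comment> \<open>\<open>S\<close> is open by continuity and null by the definition of the
    essential supremum, so it cannot contain a point.\<close>
  define S where "S = {z. Linf_norm f < ennreal \<bar>f z\<bar>}"
  have "open S"
    unfolding S_def using f by (intro open_Collect_less continuous_intros continuous_on_ennreal) auto
  moreover have "negligible S"
    using AE_lebesgue_negligible[OF esssup_AE[of "\<lambda>z. ennreal \<bar>f z\<bar>" lebesgue]]
    by (simp add: S_def Linf_norm_def not_le)
  moreover have "y \<in> S"
    using \<open>\<not> ennreal \<bar>f y\<bar> \<le> Linf_norm f\<close> by (simp add: S_def)
  ultimately show False
    using open_not_negligible by blast
qed

text \<open>Point evaluation of a continuous function is bounded by its norm, so the approximating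
  simple functions evaluated at \<open>x t\<close> converge almost everywhere to
  \<open>l t (x t)\<close>. Each is measurable, since it selects among finitely many continuous
  functions of \<open>x t\<close>. The essential norm bound then gives integrability.\<close>

lemma Linf_W1inf_along_path:
  assumes l: "l \<in> Linf_W1inf T" and x: "continuous_on {0..T} x"
  shows "(\<lambda>t. l t (x t)) absolutely_integrable_on {0..T}"
proof -
  let ?M = "lebesgue_on {0<..<T}"
  have cont: "continuous_on UNIV f" if "f \<in> W1inf" for f
    using that by (simp add: W1inf_def)
  have bd: "ennreal \<bar>f y\<bar> \<le> W1inf_norm f" if "continuous_on UNIV f" for f y
    using ennreal_abs_le_Linf_norm[OF that, of y] unfolding W1inf_norm_def
    by (rule order_trans) simp
  have lW: "l t \<in> W1inf" if "t \<in> {0<..<T}" for t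
    using l that by (simp add: Linf_W1inf_def)
  obtain s where s: "\<And>n. simple_function ?M (s n)" "\<And>n t. t \<in> {0<..<T} \<Longrightarrow> s n t \<in> W1inf"
    and conv: "AE t in ?M. (\<lambda>n. W1inf_norm (\<lambda>y. s n t y - l t y)) \<longlonglongrightarrow> 0"
    using l unfolding Linf_W1inf_def by blast
  obtain C where C: "AE t in ?M. W1inf_norm (l t) \<le> ennreal C"
    using l unfolding Linf_W1inf_def by blast
  have "x \<in> borel_measurable ?M"
    by (rule continuous_imp_measurable_on_sets_lebesgue) (auto intro: continuous_on_subset[OF x])
  have meas: "(\<lambda>t. s n t (x t)) \<in> borel_measurable ?M" for n
  proof (rule measurable_compose_countable'[where f = "\<lambda>f t. f (x t)" and g = "s n"])
    have fin: "finite (s n ` space ?M)"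
      using s(1) by (rule simple_functionD)
    then show "countable (s n ` space ?M)" by (rule countable_finite)
    show "s n \<in> ?M \<rightarrow>\<^sub>M count_space (s n ` space ?M)"
      using simple_functionD(2)[OF s(1)] fin by (subst measurable_count_space_eq2) auto
    show "(\<lambda>t. f (x t)) \<in> borel_measurable ?M" if "f \<in> s n ` space ?M" for f
    proof (rule measurable_compose[OF \<open>x \<in> borel_measurable ?M\<close> borel_measurable_continuous_onI])
      show "continuous_on UNIV f" using that s(2) cont by auto
    qed
  qed
  \<comment> \<open>After extension by 0, \<open>lim (\<lambda>n. u n t)\<close> is a measurable
    function of \<open>t\<close> even where the sequence diverges, and \<open>k\<close> agrees with
    it almost everywhere.\<close>
  define u where "u n t = (if t \<in> {0<..<T} then s n t (x t) else 0)" for n t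
  define k where "k t = (if t \<in> {0<..<T} then l t (x t) else 0)" for t
  have u: "u n \<in> borel_measurable lebesgue" for n
    unfolding u_def using meas by (subst borel_measurable_if) auto
  have "AE t in lebesgue. t \<in> {0<..<T} \<longrightarrow> (\<lambda>n. W1inf_norm (\<lambda>y. s n t y - l t y)) \<longlonglongrightarrow> 0"
    using conv by (subst (asm) AE_restrict_space_iff) auto
  then have "AE t in lebesgue. lim (\<lambda>n. u n t) = k t"
  proof eventually_elim
    case (elim t)
    show ?case
    proof (cases "t \<in> {0<..<T}")
      case True
      have "(\<lambda>n. ennreal \<bar>s n t (x t) - l t (x t)\<bar>) \<longlonglongrightarrow> 0"
      proof (rule tendsto_sandwich[OF _ _ tendsto_const])
        show "(\<lambda>n. W1inf_norm (\<lambda>y. s n t y - l t y)) \<longlonglongrightarrow> 0"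
          using elim True by simp
        have "continuous_on UNIV (\<lambda>y. s n t y - l t y)" for n
          using cont[OF s(2)[OF True]] cont[OF lW[OF True]] by (intro continuous_intros)
        then show "\<forall>\<^sub>F n in sequentially. ennreal \<bar>s n t (x t) - l t (x t)\<bar> \<le> W1inf_norm (\<lambda>y. s n t y - l t y)"
          using bd[of "\<lambda>y. s _ t y - l t y" "x t"] by auto
      qed simp
      then have "(\<lambda>n. \<bar>s n t (x t) - l t (x t)\<bar>) \<longlonglongrightarrow> 0"
        by (simp add: ennreal_tendsto_0_iff)
      then have "(\<lambda>n. s n t (x t) - l t (x t)) \<longlonglongrightarrow> 0"
        by (simp add: tendsto_rabs_zero_iff)
      then have "(\<lambda>n. s n t (x t)) \<longlonglongrightarrow> l t (x t)"
        by (rule LIM_zero_cancel)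
      then show ?thesis using True by (simp add: u_def k_def limI)
    next
      case False
      then have "u n t = 0" for n using False by (auto simp: u_def)
      then show ?thesis using False by (auto simp: k_def limI)
    qed
  qed
  then have k: "k \<in> borel_measurable lebesgue"
    by (rule borel_measurable_AE[rotated]) (use u in measurable)
  have "integrable lebesgue k"
  \<comment> \<open>\<open>ennreal\<close> sends a negative \<open>C\<close> to 0, so the real bound
    is \<open>\<bar>C\<bar>\<close>.\<close>
  proof (rule integrableI_bounded_set[of "{0<..<T}" _ _ "\<bar>C\<bar>"])
    have "AE t in lebesgue. t \<in> {0<..<T} \<longrightarrow> W1inf_norm (l t) \<le> ennreal C"
      using C by (subst (asm) AE_restrict_space_iff) auto
    then show "AE t in lebesgue. t \<in> {0<..<T} \<longrightarrow> norm (k t) \<le> \<bar>C\<bar>"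
    proof eventually_elim
      case (elim t)
      show ?case
      proof
        assume t: "t \<in> {0<..<T}"
        then have "ennreal \<bar>l t (x t)\<bar> \<le> ennreal C"
          using elim bd[OF cont[OF lW[OF t]], of "x t"] by (auto intro: order_trans)
        also have "\<dots> \<le> ennreal \<bar>C\<bar>" by (simp add: ennreal_leI)
        finally show "norm (k t) \<le> \<bar>C\<bar>"
          using t by (simp add: k_def)
      qed
    qed
    show "emeasure lebesgue {0<..<T} < \<infinity>"
      by (cases "0 \<le> T") auto
  qed (use k in \<open>auto simp: k_def\<close>)
  moreover have "k = (\<lambda>t. indicator {0<..<T} t *\<^sub>R l t (x t))"
    by (auto simp: k_def indicator_def)
  ultimately show ?thesis
    unfolding absolutely_integrable_on_Icc_iff_Ioo by (simp add: set_integrable_def)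
qed

lemma interval_lebesgue_integral_cong_AE_lebesgue:
  fixes f g :: "real \<Rightarrow> real" and a b :: real
  assumes "f \<in> borel_measurable lebesgue" "g \<in> borel_measurable lebesgue" "AE y in lebesgue. f y = g y"
  shows "(LINT y=a..b|lebesgue. f y) = (LINT y=a..b|lebesgue. g y)"
  unfolding interval_lebesgue_integral_orient
proof (rule integral_cong_AE)
  have "orient a b \<in> borel_measurable lebesgue"
    using integrable_orient by auto
  then show "(\<lambda>y. f y * orient a b y) \<in> borel_measurable lebesgue" "(\<lambda>y. g y * orient a b y) \<in> borel_measurable lebesgue"
    using assms by auto
  show "AE y in lebesgue. f y * orient a b y = g y * orient a b y"
    using assms(3) by eventually_elim simp
qed

section \<open>Equivalence of the solution concepts\<close>

text \<open>Equivalence for each single \<open>x\<close> transfers existence and uniqueness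
  together.\<close>

lemma caratheodory_iff_integral_sense:
  assumes "T > 0" "m > 0" and v: "v \<in> Linf_ge m" and l: "l \<in> Linf_W1inf T"
  shows "caratheodory_solution T v l x0 x \<longleftrightarrow> integral_sense_solution T v l x0 x"
proof (cases "x \<in> C_interval T")
  case True
  then have x: "continuous_on {0..T} x" by (simp add: C_interval_def)
  have v_pos: "v y > 0" for y
  proof -
    have "m \<le> v y" using v by (simp add: Linf_ge_def)
    with \<open>m > 0\<close> show ?thesis by linarith
  qed
  obtain v' C B where v': "v' \<in> borel_measurable borel" "\<And>y. m \<le> v' y" "\<And>y. v' y \<le> C"
    and B: "B \<in> null_sets lborel" and eq: "\<And>y. y \<notin> B \<Longrightarrow> v' y = v y"
    by (rule Linf_ge_borel_representative[OF v]) (rule that)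
  have v'_pos: "v' y > 0" for y
    using v'(2)[of y] \<open>m > 0\<close> by linarith
  define r where "r s = l s (x s)" for s
  have r: "r absolutely_integrable_on {0..T}"
    unfolding r_def[abs_def] using l x by (rule Linf_W1inf_along_path)
  have sub: "f absolutely_integrable_on {0..t}" if "f absolutely_integrable_on {0..T}" "t \<in> {0..T}"
    for f :: "real \<Rightarrow> real" and t
    by (rule absolutely_integrable_on_subinterval[OF that(1)]) (use that(2) in auto)
  have from_0: "(LINT s=0..t|lebesgue. f s) = integral {0..t} f"
    if "f absolutely_integrable_on {0..T}" "t \<in> {0..T}" for f :: "real \<Rightarrow> real" and t
    using interval_lebesgue_integral_eq_integral[OF _ sub[OF that]] that(2) by (simp add: zero_ereal_def)
  \<comment> \<open>Under \<open>dy\<close> the set \<open>B\<close> is negligible and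
    \<open>v\<close> may be replaced at once. Along the path this needs an argument, since
    \<open>x\<close> may spend positive time in \<open>B\<close>.\<close>
  have recip: "(LINT y=a..b|lebesgue. (1 / v y)) = (LINT y=a..b|lebesgue. (1 / v' y))" for a b :: real
  proof (rule interval_lebesgue_integral_cong_AE_lebesgue)
    show "(\<lambda>y. 1 / v y) \<in> borel_measurable lebesgue"
      using v by (auto simp: Linf_ge_def Linf_def)
    show "(\<lambda>y. 1 / v' y) \<in> borel_measurable lebesgue"
      by (rule measurable_completion) (use v'(1) in simp)
    have "AE y in lebesgue. y \<notin> B"
      using B by (intro AE_completion AE_not_in)
    then show "AE y in lebesgue. 1 / v y = 1 / v' y"
      by eventually_elim (simp add: eq)
  qed
  show ?thesis
  proof
    assume cs: "caratheodory_solution T v l x0 x"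
    define g where "g s = v (x s) * r s" for s
    have g: "g absolutely_integrable_on {0..T}"
      using cs unfolding caratheodory_solution_def absolutely_integrable_on_Icc_iff_Ioo
      by (simp add: g_def[abs_def] r_def)
    have xg: "x t = x0 + integral {0..t} g" if "t \<in> {0..T}" for t
      using cs that from_0[OF g that]
      by (simp add: caratheodory_solution_def g_def[abs_def] r_def)
    then have "x 0 = x0" using \<open>T > 0\<close> by simp
    with xg have path: "x t = x 0 + integral {0..t} g" if "t \<in> {0..T}" for t
      using that by simp
    have "(LINT y=x0..x t|lebesgue. (1 / v y)) = (LINT s=0..t|lebesgue. (l s (x s)))" if t: "t \<in> {0..T}" for t
    proof -
      have "(LINT y=x0..x t|lebesgue. (1 / v y)) = (LINT y=x 0..x t|lebesgue. (1 / v' y))"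
        unfolding recip \<open>x 0 = x0\<close> ..
      also have "\<dots> = integral {0..t} (\<lambda>s. 1 / v' (x s) * g s)"
      proof (rule ac_substitution_borel[OF _ sub[OF g t]])
        show "x u = x 0 + integral {0..u} g" if "u \<in> {0..t}" for u
          by (rule path) (use that t in auto)
        show "\<bar>1 / v' y\<bar> \<le> 1 / m" for y
          using v'(2)[of y] v'_pos[of y] \<open>m > 0\<close> by (simp add: frac_le)
      qed (use v'(1) t in auto)
      also have "\<dots> = integral {0..t} r"
      proof (rule integral_cong_AE_lebesgue)
        \<comment> \<open>Off \<open>B\<close> the factors \<open>v'\<close> and \<open>v\<close>
          cancel. On \<open>B\<close>, almost everywhere \<open>g s = 0\<close>, and positivity of
          \<open>v\<close> forces \<open>r s = 0\<close>, so both sides vanish.\<close>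
        have "AE s in lebesgue. s \<in> {0..T} \<longrightarrow> x s \<in> B \<longrightarrow> g s = 0"
          using g path B by (rule ac_deriv_zero_on_null_preimage)
        then show "AE s in lebesgue. s \<in> {0..t} \<longrightarrow> 1 / v' (x s) * g s = r s"
        proof eventually_elim
          case (elim s)
          then show ?case
            using t v_pos[of "x s"] by (cases "x s \<in> B") (auto simp: eq g_def)
        qed
      qed
      also have "\<dots> = (LINT s=0..t|lebesgue. (l s (x s)))"
        using from_0[OF r t] by (simp add: r_def[abs_def])
      finally show ?thesis .
    qed
    then show "integral_sense_solution T v l x0 x"
      using True by (simp add: integral_sense_solution_def)
  next
    assume iss: "integral_sense_solution T v l x0 x"
    define F where "F z = (LINT y=x0..z|lebesgue. (1 / v' y))" for z :: real
    obtain G where G: "G \<in> borel_measurable borel" "\<And>z. G (F z) = z"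
      and FG: "\<And>p q. (LINT u=F p..F q|lebesgue. v' (G u)) = q - p"
      by (rule antiderivative_reciprocal_inverse[OF v'(1) \<open>m > 0\<close> v'(2,3), of x0, folded F_def]) (rule that)
    have Fx: "F (x t) = integral {0..t} r" if t: "t \<in> {0..T}" for t
    proof -
      have "F (x t) = (LINT s=0..t|lebesgue. (l s (x s)))"
        using iss t by (simp add: integral_sense_solution_def F_def recip)
      also have "\<dots> = integral {0..t} r"
        using from_0[OF r t] by (simp add: r_def[abs_def])
      finally show ?thesis .
    qed
    \<comment> \<open>The initial condition is hidden in the integral equation at time 0; the left
      inverse \<open>G\<close> recovers it.\<close>
    have "F (x 0) = 0" using Fx[of 0] \<open>T > 0\<close> by simp
    moreover have "F x0 = 0"
      by (simp add: F_def interval_lebesgue_integral_def einterval_same set_lebesgue_integral_def)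
    ultimately have "x 0 = x0" using G(2) by metis
    define g' where "g' s = v' (x s) * r s" for s
    have path: "x t = x 0 + integral {0..t} g'" if t: "t \<in> {0..T}" for t
    proof -
      \<comment> \<open>At this stage \<open>x\<close> is not yet known to be an indefinite
        integral, but \<open>F \<circ> x\<close> is one, of \<open>r\<close>; hence the substitution
        runs along it.\<close>
      have "x t - x 0 = (LINT u=F (x 0)..F (x t)|lebesgue. v' (G u))"
        by (simp add: FG)
      also have "\<dots> = integral {0..t} (\<lambda>s. v' (G (F (x s))) * r s)"
      proof (rule ac_substitution_borel[OF _ sub[OF r t]])
        show "F (x u) = F (x 0) + integral {0..u} r" if "u \<in> {0..t}" for u
          using Fx[of u] that t \<open>F (x 0) = 0\<close> by simp
        show "(\<lambda>u. v' (G u)) \<in> borel_measurable borel"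
          using v'(1) G(1) by simp
        show "\<bar>v' (G u)\<bar> \<le> C" for u
          using v'(3)[of "G u"] v'_pos[of "G u"] by simp
      qed (use t in auto)
      finally show ?thesis by (simp add: G(2) g'_def[abs_def])
    qed
    have "\<bar>v' y\<bar> \<le> C" for y
      using v'(3)[of y] v'_pos[of y] by simp
    then have g': "g' absolutely_integrable_on {0..T}"
      unfolding g'_def[abs_def] using x v'(1) r by (intro absolutely_integrable_bounded_comp)
    define g where "g s = v (x s) * l s (x s)" for s
    \<comment> \<open>By \<open>path\<close>, \<open>x\<close> is now an indefinite integral of
      \<open>g'\<close>. Where \<open>x s\<close> lies in \<open>B\<close>, almost everywhere
      \<open>g' s = 0\<close>; positivity of \<open>v'\<close> gives \<open>r s = 0\<close>, and
      thus \<open>g s = 0\<close> as well.\<close>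
    have "AE s in lebesgue. s \<in> {0..T} \<longrightarrow> x s \<in> B \<longrightarrow> g' s = 0"
      using g' path B by (rule ac_deriv_zero_on_null_preimage)
    then have gg': "AE s in lebesgue. s \<in> {0..T} \<longrightarrow> g' s = g s"
    proof eventually_elim
      case (elim s)
      then show ?case
        using v'_pos[of "x s"] by (cases "x s \<in> B") (auto simp: eq g_def g'_def r_def)
    qed
    then have g: "g absolutely_integrable_on {0..T}"
      using g' by (rule absolutely_integrable_cong_AE_lebesgue)
    then have gIoo: "g absolutely_integrable_on {0<..<T}"
      by (simp add: absolutely_integrable_on_Icc_iff_Ioo)
    then have "g \<in> borel_measurable (lebesgue_on {0<..<T})"
      by (intro borel_measurable_integrable absolutely_integrable_imp_integrable) auto
    moreover have "x t = x0 + (LINT s=0..t|lebesgue. g s)" if t: "t \<in> {0..T}" for t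
    proof -
      have "integral {0..t} g' = integral {0..t} g"
      proof (rule integral_cong_AE_lebesgue)
        show "AE s in lebesgue. s \<in> {0..t} \<longrightarrow> g' s = g s"
          using gg' by eventually_elim (use t in auto)
      qed
      then show ?thesis
        using path[OF t] from_0[OF g t] \<open>x 0 = x0\<close> by simp
    qed
    ultimately show "caratheodory_solution T v l x0 x"
      using True gIoo by (simp add: caratheodory_solution_def g_def[abs_def])
  qed
qed (simp add: caratheodory_solution_def integral_sense_solution_def)

theorem lemma2p1:
  fixes T vmin x0 :: real
    and v :: "real \<Rightarrow> real"
    and l :: "real \<Rightarrow> real \<Rightarrow> real"
  assumes "T > 0"
    and "vmin > 0"
    and "v \<in> Linf_ge vmin"
    and "l \<in> Linf_W1inf T"
  shows "(\<exists>!x. caratheodory_solution T v l x0 x) \<longleftrightarrow> (\<exists>!x. integral_sense_solution T v l x0 x)"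
  using caratheodory_iff_integral_sense[OF assms] by simp

end
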